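(* Let $\mathcal I=\mathcal I_1\|\cdots\|\mathcal I_n$ be a closed IOSA obtained as the parallel composition of pairwise compatible IOSAs. If $\mathcal I$ potentially reaches a non-confluent state, then there are actions $a,b\in\mathcal A^{\mathsf u}\cap\mathcal A^{\mathsf o}$ such that some $\mathcal I_i$ is not confluent w.r.t. $a$ and $b$, and there are actions $c,d$ with $c\leadsto^*a$ and $d\leadsto^*b$ such that either (i) $c,d\in\bigcup_{i=1}^n(\mathrm{uen}(s^0_i)\cap\mathcal A^{\mathsf o}_i)$, where $s^0_i$ is the initial state of $\mathcal I_i$, or (ii) there is some $e\in\mathcal A$ and (possibly empty) sets $B_1,\dots,B_n$ with $B_i$ spontaneously enabled by $e$ in $\mathcal I_i$, such that $c,d\in\bigcup_{i=1}^nB_i$.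
   Context: An IOSA is a tuple $\mathcal I=(\mathcal S,\mathcal A,\mathcal C,\rightarrow,C_0,s_0)$: $\mathcal S$ denumerable states; $\mathcal A$ denumerable actions partitioned into inputs $\mathcal A^{\mathsf i}$ and outputs $\mathcal A^{\mathsf o}$, with urgent subset $\mathcal A^{\mathsf u}\subseteq\mathcal A$ and silent action $\tau\in\mathcal A^{\mathsf u}\cap\mathcal A^{\mathsf o}$; $\mathcal C$ a finite set of clocks, each with a continuous probability measure $\mu_x$ on $\mathbb R$ with $\mu_x(\mathbb R_{>0})=1$; transitions $s\xrightarrow{C,a,C'}s'$ with $C,C'\subseteq\mathcal C$; $C_0\subseteq\mathcal C$; initial state $s_0$. With $\_$ an existentially quantified parameter, $\mathrm{enabling}(s)=\{y\mid s\xrightarrow{\{y\},\_,\_}\_\}$ and $s$ is stable if no $a\in\mathcal A^{\mathsf u}\cap\mathcal A^{\mathsf o}$ has $s\xrightarrow{\emptyset,a,\_}\_$. Requirements: (a) $a\in\mathcal A^{\mathsf i}\cup\mathcal A^{\mathsf u}$ implies $C=\emptyset$; (b) $a\in\mathcal A^{\mathsf o}\setminus\mathcal A^{\mathsf u}$ implies $C$ singleton; (c) $s\xrightarrow{\{x\},a_1,C_1}s_1$, $s\xrightarrow{\{x\},a_2,C_2}s_2$ imply $a_1=a_2,C_1=C_2,s_1=s_2$; (d) every input is enabled in every state; (e) inputs are deterministic (same $C'$ and target); (f) there is $\mathrm{active}:\mathcal S\to2^{\mathcal C}$ with $\mathrm{active}(s_0)\subseteq C_0$, $\mathrm{enabling}(s)\subseteq\mathrm{active}(s)$,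 equality if $s$ stable, and $\mathrm{active}(s)\subseteq(\mathrm{active}(t)\setminus C)\cup C'$ whenever $t\xrightarrow{C,a,C'}s$. Closed means $\mathcal A^{\mathsf i}=\emptyset$. Compatibility of $\mathcal I_1,\mathcal I_2$: $\mathcal A^{\mathsf o}_1\cap\mathcal A^{\mathsf o}_2\subseteq\{\tau\}$, $\mathcal C_1\cap\mathcal C_2=\emptyset$, $\mathcal A_1\cap\mathcal A^{\mathsf u}_2=\mathcal A_2\cap\mathcal A^{\mathsf u}_1$. Composition $\mathcal I_1\|\mathcal I_2$: states $s_1\|s_2\in\mathcal S_1\times\mathcal S_2$, initial $s^0_1\|s^0_2$, clocks $\mathcal C_1\cup\mathcal C_2$, $C_0=C_0^1\cup C_0^2$, $\mathcal A^{\mathsf o}=\mathcal A^{\mathsf o}_1\cup\mathcal A^{\mathsf o}_2$, $\mathcal A^{\mathsf i}=(\mathcal A^{\mathsf i}_1\cup\mathcal A^{\mathsf i}_2)\setminus\mathcal A^{\mathsf o}$, $\mathcal A^{\mathsf u}=\mathcal A^{\mathsf u}_1\cup\mathcal A^{\mathsf u}_2$, transitions: (R1) $s_1\xrightarrow{C,a,C'}_1s_1'$ with $a\in(\mathcal A_1\setminus\mathcal A_2)\cup\{\tau\}$ gives $s_1\|s_2\xrightarrow{C,a,C'}s_1'\|s_2$; (R2) symmetric for $\mathcal I_2$; (R3) $s_1\xrightarrow{C_1,a,C_1'}_1s_1'$ and $s_2\xrightarrow{C_2,a,C_2'}_2s_2'$ with $a\in(\mathcal A_1\cap\mathcal A_2)\setminus\{\tau\}$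 give $s_1\|s_2\xrightarrow{C_1\cup C_2,a,C_1'\cup C_2'}s_1'\|s_2'$. $n$-ary composition iterates this. Confluence: $\mathcal I$ is confluent w.r.t. $a,b\in\mathcal A^{\mathsf u}$ if for all $s\xrightarrow{\emptyset,a,C_1}s_1$ and $s\xrightarrow{\emptyset,b,C_2}s_2$ there is $s_3$ with $s_1\xrightarrow{\emptyset,b,C_2}s_3$ and $s_2\xrightarrow{\emptyset,a,C_1}s_3$. A state $s$ is non-confluent if there exist urgent $a,b$ and transitions $s\xrightarrow{\emptyset,a,C_1}s_1$, $s\xrightarrow{\emptyset,b,C_2}s_2$ with no such $s_3$. $\mathrm{uen}(s)=\{a\in\mathcal A^{\mathsf u}\mid s\xrightarrow{\_,a,\_}\_\}$. A path $s_0\xrightarrow{\_,a_0,\_}s_1\cdots\xrightarrow{\_,a_{n-1},\_}s_n$ ($n\ge0$) from the initial state is plausible if for all $i<n$, whenever $s_i\xrightarrow{\_,b,\_}\_$ for some $b\in\mathcal A^{\mathsf u}\cap\mathcal A^{\mathsf o}$, then $a_i\in\mathcal A^{\mathsf u}$; $s_n$ is then potentially reachable. A set $B\subseteq\mathcal A^{\mathsf u}\cap\mathcal A^{\mathsf o}$ is spontaneously enabled by $a\in\mathcal A\setminus\mathcal A^{\mathsf u}$ in $\mathcal I$ if $B=\emptyset$ or there are potentially reachable $s,s'$ with $s$ stable, $s\xrightarrow{\_,a,\_}s'$ and $B\subseteq\mathrm{uen}(s')$. For $a\in\mathcal A^{\mathsf u}$, $b\in\mathcal A^{\mathsf u}\cap\mathcal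 A^{\mathsf o}$, $a$ triggers $b$ in $\mathcal I$ if there are potentially reachable $s_1,s_2,s_3$ with $s_1\xrightarrow{\_,a,\_}s_2\xrightarrow{\_,b,\_}s_3$ and, if $a\ne b$, $b\notin\mathrm{uen}(s_1)$. The approximate triggering relation of $\mathcal I_1\|\cdots\|\mathcal I_n$ is ${\leadsto}=\bigcup_{i=1}^n\{(a,b)\mid a\text{ triggers }b\text{ in }\mathcal I_i\}$, and $\leadsto^*$ is its reflexive transitive closure. *)

theory Defs
  imports "HOL-Probability.Probability"
begin

text \<open>
  The silent action is the same for all automata under consideration, so it is not a
  component of the record but a parameter \<open>tau\<close> of the notions that refer to it.
  A tuple \<open>(s, C, a, C', s')\<close> stands for the transition from \<open>s\<close> to \<open>s'\<close> that waits for the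
  clocks in \<open>C\<close>, performs \<open>a\<close> and resets the clocks in \<open>C'\<close>.
\<close>

record ('s, 'a, 'c) iosa =
  states :: "'s set"
  inputs :: "'a set"
  outputs :: "'a set"
  urgent :: "'a set"
  clocks :: "'c set"
  clock_law :: "'c \<Rightarrow> real measure"
  transitions :: "('s \<times> 'c set \<times> 'a \<times> 'c set \<times> 's) set"
  init_clocks :: "'c set"
  init_state :: "'s"

definition actions :: "('s, 'a, 'c) iosa \<Rightarrow> 'a set" where
  "actions I = inputs I \<union> outputs I"

definition enabling :: "('s, 'a, 'c) iosa \<Rightarrow> 's \<Rightarrow> 'c set" where
  "enabling I s = {y. \<exists>a C' s'. (s, {y}, a, C', s') \<in> transitions I}"

definition stable :: "('s, 'a, 'c) iosa \<Rightarrow> 's \<Rightarrow> bool" where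
  "stable I s \<longleftrightarrow>
     \<not> (\<exists>a \<in> urgent I \<inter> outputs I. \<exists>C' s'. (s, {}, a, C', s') \<in> transitions I)"

text \<open>
  ``Denumerable'' is read as finite or countably infinite, and a ``continuous'' probability
  measure on the reals is a Borel probability measure without atoms (no density is required).
\<close>

locale IOSA =
  fixes tau :: 'a and I :: "('s, 'a, 'c) iosa"
  assumes countable_states: "countable (states I)"
    and countable_actions: "countable (actions I)"
    and inputs_outputs_disjoint: "inputs I \<inter> outputs I = {}"
    and urgent_actions: "urgent I \<subseteq> actions I"
    and tau_urgent_output: "tau \<in> urgent I \<inter> outputs I"
    and finite_clocks: "finite (clocks I)"
    and clock_law_real_distribution: "\<And>x. x \<in> clocks I \<Longrightarrow> real_distribution (clock_law I x)"
    and clock_law_continuous: "\<And>x r. x \<in> clocks I \<Longrightarrow> measure (clock_law I x) {r} = 0"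
    and clock_law_positive: "\<And>x. x \<in> clocks I \<Longrightarrow> measure (clock_law I x) {0<..} = 1"
    and transitions_wf:
      "transitions I \<subseteq>
         states I \<times> Pow (clocks I) \<times> actions I \<times> Pow (clocks I) \<times> states I"
    and init_clocks_wf: "init_clocks I \<subseteq> clocks I"
    and init_state_wf: "init_state I \<in> states I"
    and input_or_urgent_no_clock:
      "\<And>s C a C' s'. (s, C, a, C', s') \<in> transitions I \<Longrightarrow> a \<in> inputs I \<union> urgent I
         \<Longrightarrow> C = {}"
    and nonurgent_output_one_clock:
      "\<And>s C a C' s'. (s, C, a, C', s') \<in> transitions I \<Longrightarrow> a \<in> outputs I - urgent I
         \<Longrightarrow> is_singleton C"
    and clock_deterministic:
      "\<And>s x a\<^sub>1 C\<^sub>1 s\<^sub>1 a\<^sub>2 C\<^sub>2 s\<^sub>2. (s, {x}, a\<^sub>1, C\<^sub>1, s\<^sub>1) \<in> transitions I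
         \<Longrightarrow> (s, {x}, a\<^sub>2, C\<^sub>2, s\<^sub>2) \<in> transitions I
         \<Longrightarrow> a\<^sub>1 = a\<^sub>2 \<and> C\<^sub>1 = C\<^sub>2 \<and> s\<^sub>1 = s\<^sub>2"
    and input_enabled:
      "\<And>s a. s \<in> states I \<Longrightarrow> a \<in> inputs I
         \<Longrightarrow> \<exists>C C' s'. (s, C, a, C', s') \<in> transitions I"
    and input_deterministic:
      "\<And>s a C\<^sub>1 C\<^sub>1' s\<^sub>1 C\<^sub>2 C\<^sub>2' s\<^sub>2. a \<in> inputs I
         \<Longrightarrow> (s, C\<^sub>1, a, C\<^sub>1', s\<^sub>1) \<in> transitions I
         \<Longrightarrow> (s, C\<^sub>2, a, C\<^sub>2', s\<^sub>2) \<in> transitions I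
         \<Longrightarrow> C\<^sub>1' = C\<^sub>2' \<and> s\<^sub>1 = s\<^sub>2"
    and active_clocks:
      "\<exists>active :: 's \<Rightarrow> 'c set.
         (\<forall>s \<in> states I. active s \<subseteq> clocks I) \<and>
         active (init_state I) \<subseteq> init_clocks I \<and>
         (\<forall>s \<in> states I. enabling I s \<subseteq> active s) \<and>
         (\<forall>s \<in> states I. stable I s \<longrightarrow> enabling I s = active s) \<and>
         (\<forall>t C a C' s. (t, C, a, C', s) \<in> transitions I \<longrightarrow> active s \<subseteq> (active t - C) \<union> C')"

definition closed_iosa :: "('s, 'a, 'c) iosa \<Rightarrow> bool" where
  "closed_iosa I \<longleftrightarrow> inputs I = {}"

definition compatible :: "'a \<Rightarrow> ('s, 'a, 'c) iosa \<Rightarrow> ('t, 'a, 'c) iosa \<Rightarrow> bool" where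
  "compatible tau I J \<longleftrightarrow>
     outputs I \<inter> outputs J \<subseteq> {tau} \<and>
     clocks I \<inter> clocks J = {} \<and>
     actions I \<inter> urgent J = actions J \<inter> urgent I"

definition par ::
  "'a \<Rightarrow> ('s, 'a, 'c) iosa \<Rightarrow> ('t, 'a, 'c) iosa \<Rightarrow> ('s \<times> 't, 'a, 'c) iosa" where
  "par tau I J = \<lparr>
     states = states I \<times> states J,
     inputs = (inputs I \<union> inputs J) - (outputs I \<union> outputs J),
     outputs = outputs I \<union> outputs J,
     urgent = urgent I \<union> urgent J,
     clocks = clocks I \<union> clocks J,
     clock_law = (\<lambda>x. if x \<in> clocks I then clock_law I x else clock_law J x),
     transitions =
       {((s, t), C, a, C', (s', t)) | s t C a C' s'.
          (s, C, a, C', s') \<in> transitions I \<and> t \<in> states J \<and>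
          a \<in> (actions I - actions J) \<union> {tau}} \<union>
       {((s, t), C, a, C', (s, t')) | s t C a C' t'.
          (t, C, a, C', t') \<in> transitions J \<and> s \<in> states I \<and>
          a \<in> (actions J - actions I) \<union> {tau}} \<union>
       {((s, t), C\<^sub>1 \<union> C\<^sub>2, a, C\<^sub>1' \<union> C\<^sub>2', (s', t')) | s t C\<^sub>1 C\<^sub>2 a C\<^sub>1' C\<^sub>2' s' t'.
          (s, C\<^sub>1, a, C\<^sub>1', s') \<in> transitions I \<and> (t, C\<^sub>2, a, C\<^sub>2', t') \<in> transitions J \<and>
          a \<in> (actions I \<inter> actions J) - {tau}},
     init_clocks = init_clocks I \<union> init_clocks J,
     init_state = (init_state I, init_state J)\<rparr>"

definition map_states :: "('s \<Rightarrow> 't) \<Rightarrow> ('s, 'a, 'c) iosa \<Rightarrow> ('t, 'a, 'c) iosa" where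
  "map_states f I = \<lparr>
     states = f ` states I,
     inputs = inputs I,
     outputs = outputs I,
     urgent = urgent I,
     clocks = clocks I,
     clock_law = clock_law I,
     transitions = (\<lambda>(s, C, a, C', s'). (f s, C, a, C', f s')) ` transitions I,
     init_clocks = init_clocks I,
     init_state = f (init_state I)\<rparr>"

text \<open>
  The iterated composition \<open>(\<dots>(I\<^sub>1 \<parallel> I\<^sub>2) \<parallel> \<dots>) \<parallel> I\<^sub>n\<close>.  The type of its nested pairs of
  states would depend on \<open>n\<close>, so after each binary composition the pair
  \<open>(((s\<^sub>1, s\<^sub>2), \<dots>), s\<^sub>k)\<close> is renamed, injectively, to the list \<open>[s\<^sub>1, \<dots>, s\<^sub>k]\<close>.
  Only meaningful for a nonempty list of automata.
\<close>

definition par_list :: "'a \<Rightarrow> ('s, 'a, 'c) iosa list \<Rightarrow> ('s list, 'a, 'c) iosa" where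
  "par_list tau Is =
     foldl (\<lambda>J K. map_states (\<lambda>(ss, s). ss @ [s]) (par tau J K))
       (map_states (\<lambda>s. [s]) (hd Is)) (tl Is)"

definition confluent_at :: "('s, 'a, 'c) iosa \<Rightarrow> 's \<Rightarrow> 'a \<Rightarrow> 'a \<Rightarrow> bool" where
  "confluent_at I s a b \<longleftrightarrow>
     (\<forall>C\<^sub>1 s\<^sub>1 C\<^sub>2 s\<^sub>2.
        (s, {}, a, C\<^sub>1, s\<^sub>1) \<in> transitions I \<and> (s, {}, b, C\<^sub>2, s\<^sub>2) \<in> transitions I \<longrightarrow>
        (\<exists>s\<^sub>3. (s\<^sub>1, {}, b, C\<^sub>2, s\<^sub>3) \<in> transitions I \<and> (s\<^sub>2, {}, a, C\<^sub>1, s\<^sub>3) \<in> transitions I))"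

definition confluent_wrt :: "('s, 'a, 'c) iosa \<Rightarrow> 'a \<Rightarrow> 'a \<Rightarrow> bool" where
  "confluent_wrt I a b \<longleftrightarrow> (\<forall>s \<in> states I. confluent_at I s a b)"

definition nonconfluent_state :: "('s, 'a, 'c) iosa \<Rightarrow> 's \<Rightarrow> bool" where
  "nonconfluent_state I s \<longleftrightarrow> (\<exists>a \<in> urgent I. \<exists>b \<in> urgent I. \<not> confluent_at I s a b)"

definition uen :: "('s, 'a, 'c) iosa \<Rightarrow> 's \<Rightarrow> 'a set" where
  "uen I s = {a \<in> urgent I. \<exists>C C' s'. (s, C, a, C', s') \<in> transitions I}"

text \<open>The path is \<open>ss 0 \<rightarrow> \<dots> \<rightarrow> ss n\<close> with the action \<open>as i\<close> on its \<open>i\<close>-th step.\<close>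

definition plausible_path :: "('s, 'a, 'c) iosa \<Rightarrow> nat \<Rightarrow> (nat \<Rightarrow> 's) \<Rightarrow> (nat \<Rightarrow> 'a) \<Rightarrow> bool" where
  "plausible_path I n ss as \<longleftrightarrow>
     ss 0 = init_state I \<and>
     (\<forall>i<n. \<exists>C C'. (ss i, C, as i, C', ss (Suc i)) \<in> transitions I) \<and>
     (\<forall>i<n. (\<exists>b \<in> urgent I \<inter> outputs I. \<exists>C C' s'. (ss i, C, b, C', s') \<in> transitions I)
        \<longrightarrow> as i \<in> urgent I)"

definition potentially_reachable :: "('s, 'a, 'c) iosa \<Rightarrow> 's \<Rightarrow> bool" where
  "potentially_reachable I s \<longleftrightarrow> (\<exists>n ss as. plausible_path I n ss as \<and> ss n = s)"

text \<open>
  The empty set is spontaneously enabled by every action, including those that are not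
  actions of \<open>I\<close>: a component that does not take part in an action contributes no spontaneously
  enabled action.
\<close>

definition spontaneously_enabled :: "('s, 'a, 'c) iosa \<Rightarrow> 'a \<Rightarrow> 'a set \<Rightarrow> bool" where
  "spontaneously_enabled I a B \<longleftrightarrow>
     B \<subseteq> urgent I \<inter> outputs I \<and>
     (B = {} \<or>
      a \<in> actions I - urgent I \<and>
      (\<exists>s s' C C'. potentially_reachable I s \<and> potentially_reachable I s' \<and> stable I s \<and>
         (s, C, a, C', s') \<in> transitions I \<and> B \<subseteq> uen I s'))"

definition triggers :: "('s, 'a, 'c) iosa \<Rightarrow> 'a \<Rightarrow> 'a \<Rightarrow> bool" where
  "triggers I a b \<longleftrightarrow>
     a \<in> urgent I \<and> b \<in> urgent I \<inter> outputs I \<and>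
     (\<exists>s\<^sub>1 s\<^sub>2 s\<^sub>3 C\<^sub>1 C\<^sub>1' C\<^sub>2 C\<^sub>2'.
        potentially_reachable I s\<^sub>1 \<and> potentially_reachable I s\<^sub>2 \<and> potentially_reachable I s\<^sub>3 \<and>
        (s\<^sub>1, C\<^sub>1, a, C\<^sub>1', s\<^sub>2) \<in> transitions I \<and> (s\<^sub>2, C\<^sub>2, b, C\<^sub>2', s\<^sub>3) \<in> transitions I \<and>
        (a \<noteq> b \<longrightarrow> b \<notin> uen I s\<^sub>1))"

definition approx_triggering :: "('s, 'a, 'c) iosa list \<Rightarrow> ('a \<times> 'a) set" where
  "approx_triggering Is = (\<Union>i<length Is. {(a, b). triggers (Is ! i) a b})"

end

theory Submission
  imports Defs
begin

text \<open>
  Component \<open>i\<close> of a composite state has an urgent output enabled exactly when the composite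
  state has it enabled, because every other component knowing that action has it as an input.
  Hence plausible paths of the composition project to plausible paths of the components, and a
  plausible non-urgent step leaves every component in a stable state.  Along a plausible path,
  the enabled urgent outputs are therefore all triggered, transitively, from those enabled
  initially or right after the last non-urgent step.
\<close>

section \<open>Potential reachability: path extension and induction along plausible paths\<close>

lemma potentially_reachable_init: "potentially_reachable I (init_state I)"
  unfolding potentially_reachable_def plausible_path_def
  by (rule exI[of _ 0], rule exI[of _ "\<lambda>_. init_state I"]) simp

text \<open>Restates the premise of plausibility through \<open>uen\<close>, the form in which it
  can later be compared between the composition and its components.\<close>

lemma uen_outputs_nonempty_iff:
  "uen I s \<inter> outputs I \<noteq> {} \<longleftrightarrow>
     (\<exists>b \<in> urgent I \<inter> outputs I. \<exists>C C' s'. (s, C, b, C', s') \<in> transitions I)"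
  by (auto simp: uen_def)

lemma potentially_reachable_step:
  assumes "potentially_reachable I s" and step: "(s, C, a, C', t) \<in> transitions I"
    and urg: "uen I s \<inter> outputs I \<noteq> {} \<Longrightarrow> a \<in> urgent I"
  shows "potentially_reachable I t"
proof -
  obtain n ss as where path: "plausible_path I n ss as" and "ss n = s"
    using assms(1) by (auto simp: potentially_reachable_def)
  then have "plausible_path I (Suc n) (ss(Suc n := t)) (as(n := a))"
    using step urg unfolding plausible_path_def uen_outputs_nonempty_iff[symmetric]
    by (auto simp: less_Suc_eq)
  then show ?thesis
    unfolding potentially_reachable_def by (metis fun_upd_same)
qed

text \<open>Every state on a plausible path is itself potentially reachable, so the step case may
  assume this together with the plausibility condition on the action taken.\<close>

lemma potentially_reachable_induct [consumes 1, case_names init step]: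
  assumes "potentially_reachable I s"
    and "P (init_state I)"
    and "\<And>s C a C' t. potentially_reachable I s \<Longrightarrow> P s \<Longrightarrow> (s, C, a, C', t) \<in> transitions I
           \<Longrightarrow> (uen I s \<inter> outputs I \<noteq> {} \<Longrightarrow> a \<in> urgent I) \<Longrightarrow> P t"
  shows "P s"
proof -
  obtain n ss as where path: "plausible_path I n ss as" and n: "ss n = s"
    using assms(1) by (auto simp: potentially_reachable_def)
  have "i \<le> n \<Longrightarrow> potentially_reachable I (ss i) \<and> P (ss i)" for i
  proof (induction i)
    case 0
    then show ?case
      using path assms(2) potentially_reachable_init by (simp add: plausible_path_def)
  next
    case (Suc i)
    then have "i < n" by simp
    then obtain C C' where "(ss i, C, as i, C', ss (Suc i)) \<in> transitions I"
      using path unfolding plausible_path_def by blast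
    moreover have "uen I (ss i) \<inter> outputs I \<noteq> {} \<Longrightarrow> as i \<in> urgent I"
      using path Suc.prems unfolding plausible_path_def uen_outputs_nonempty_iff[symmetric] by auto
    ultimately show ?case
      using Suc assms(3) potentially_reachable_step by (metis Suc_leD)
  qed
  then show ?thesis using n by blast
qed

section \<open>Transitions of the iterated composition as joint steps of the components\<close>

text \<open>\<open>P\<close> holds the indices of the components that move. A synchronising action
  moves every component that knows it, whereas \<open>tau\<close> never synchronises and moves
  exactly one.\<close>

definition participants :: "'a \<Rightarrow> ('s, 'a, 'c) iosa list \<Rightarrow> 'a \<Rightarrow> nat set \<Rightarrow> bool" where
  "participants tau Is a P \<longleftrightarrow>
     P \<noteq> {} \<and> P \<subseteq> {..<length Is} \<and>
     (if a = tau then is_singleton P else P = {i. i < length Is \<and> a \<in> actions (Is ! i)})"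

text \<open>The families \<open>Cs\<close> and \<open>Cs'\<close> are parameters, not quantified
  inside, so that proofs can refer to the clock sets of each component. Resting components must be
  in proper states too, as the interleaving rules of \<open>par\<close> demand.\<close>

definition joint_step ::
  "'a \<Rightarrow> ('s, 'a, 'c) iosa list \<Rightarrow> nat set \<Rightarrow> (nat \<Rightarrow> 'c set) \<Rightarrow> (nat \<Rightarrow> 'c set) \<Rightarrow>
    's list \<Rightarrow> 'c set \<Rightarrow> 'a \<Rightarrow> 'c set \<Rightarrow> 's list \<Rightarrow> bool" where
  "joint_step tau Is P Cs Cs' ss C a C' ss' \<longleftrightarrow>
     participants tau Is a P \<and>
     length ss = length Is \<and> length ss' = length Is \<and>
     (\<forall>i<length Is. ss ! i \<in> states (Is ! i)) \<and>
     (\<forall>i\<in>P. (ss ! i, Cs i, a, Cs' i, ss' ! i) \<in> transitions (Is ! i)) \<and>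
     (\<forall>i<length Is. i \<notin> P \<longrightarrow> ss' ! i = ss ! i) \<and>
     C = (\<Union>i\<in>P. Cs i) \<and> C' = (\<Union>i\<in>P. Cs' i)"

lemma map_states_transitionI:
  "(s, C, a, C', s') \<in> transitions I \<Longrightarrow> (f s, C, a, C', f s') \<in> transitions (map_states f I)"
  by (force simp: map_states_def)

lemma par_transition_iff:
  "((s, t), C, a, C', (s', t')) \<in> transitions (par tau I J) \<longleftrightarrow>
     (s, C, a, C', s') \<in> transitions I \<and> t' = t \<and> t \<in> states J \<and>
       a \<in> (actions I - actions J) \<union> {tau} \<or>
     (t, C, a, C', t') \<in> transitions J \<and> s' = s \<and> s \<in> states I \<and>
       a \<in> (actions J - actions I) \<union> {tau} \<or>
     (\<exists>C\<^sub>1 C\<^sub>1' C\<^sub>2 C\<^sub>2'. (s, C\<^sub>1, a, C\<^sub>1', s') \<in> transitions I \<and> (t, C\<^sub>2, a, C\<^sub>2', t') \<in> transitions J \<and>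
       a \<in> (actions I \<inter> actions J) - {tau} \<and> C = C\<^sub>1 \<union> C\<^sub>2 \<and> C' = C\<^sub>1' \<union> C\<^sub>2')"
  by (auto simp: par_def)

lemma par_list_single: "par_list tau [K] = map_states (\<lambda>s. [s]) K"
  by (simp add: par_list_def)

lemma par_list_snoc:
  "Is \<noteq> [] \<Longrightarrow> par_list tau (Is @ [K]) = map_states (\<lambda>(ss, s). ss @ [s]) (par tau (par_list tau Is) K)"
  by (simp add: par_list_def)

lemma outputs_par_list: "Is \<noteq> [] \<Longrightarrow> outputs (par_list tau Is) = (\<Union>K\<in>set Is. outputs K)"
proof (induction Is rule: rev_nonempty_induct)
  case (snoc K Is)
  then show ?case by (auto simp: par_list_snoc map_states_def par_def)
qed (auto simp: par_list_single map_states_def)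

lemma urgent_par_list: "Is \<noteq> [] \<Longrightarrow> urgent (par_list tau Is) = (\<Union>K\<in>set Is. urgent K)"
proof (induction Is rule: rev_nonempty_induct)
  case (snoc K Is)
  then show ?case by (auto simp: par_list_snoc map_states_def par_def)
qed (auto simp: par_list_single map_states_def)

text \<open>An input matched by an output leaves \<open>inputs\<close> but is still counted in
  \<open>outputs\<close>, so composition loses no action.\<close>

lemma actions_par_list: "Is \<noteq> [] \<Longrightarrow> actions (par_list tau Is) = (\<Union>K\<in>set Is. actions K)"
proof (induction Is rule: rev_nonempty_induct)
  case (snoc K Is)
  have "actions (par_list tau (Is @ [K])) = actions (par_list tau Is) \<union> actions K"
    using snoc.hyps by (auto simp: par_list_snoc map_states_def par_def actions_def)
  then show ?case using snoc by auto
qed (auto simp: par_list_single map_states_def actions_def)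

lemma init_state_par_list: "Is \<noteq> [] \<Longrightarrow> init_state (par_list tau Is) = map init_state Is"
proof (induction Is rule: rev_nonempty_induct)
  case (snoc K Is)
  then show ?case by (auto simp: par_list_snoc map_states_def par_def)
qed (auto simp: par_list_single map_states_def)

lemma states_par_list:
  "Is \<noteq> [] \<Longrightarrow> states (par_list tau Is) =
     {ss. length ss = length Is \<and> (\<forall>i<length Is. ss ! i \<in> states (Is ! i))}"
proof (induction Is rule: rev_nonempty_induct)
  case (single K)
  then show ?case by (auto simp: par_list_single map_states_def length_Suc_conv)
next
  case (snoc K Is)
  have eq: "states (par_list tau (Is @ [K])) =
      {ss @ [s] | ss s. ss \<in> states (par_list tau Is) \<and> s \<in> states K}"
    using snoc.hyps by (auto simp: par_list_snoc map_states_def par_def)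
  show ?case
  proof (intro set_eqI iffI)
    fix xs assume "xs \<in> states (par_list tau (Is @ [K]))"
    then show "xs \<in> {ss. length ss = length (Is @ [K]) \<and>
        (\<forall>i<length (Is @ [K]). ss ! i \<in> states ((Is @ [K]) ! i))}"
      unfolding eq using snoc.IH by (auto simp: nth_append less_Suc_eq)
  next
    fix xs assume xs: "xs \<in> {ss. length ss = length (Is @ [K]) \<and>
        (\<forall>i<length (Is @ [K]). ss ! i \<in> states ((Is @ [K]) ! i))}"
    then obtain ss s where "xs = ss @ [s]" "length ss = length Is"
      by (auto simp: length_Suc_conv_rev)
    with xs show "xs \<in> states (par_list tau (Is @ [K]))"
      unfolding eq using snoc.IH by (auto simp: nth_append less_Suc_eq)
  qed
qed

text \<open>The three branches mirror the rules of binary composition: only the new component moves,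
  it synchronises with earlier ones, or it rests.\<close>

lemma participants_snoc:
  "participants tau (Is @ [K]) a P \<longleftrightarrow>
     (if length Is \<in> P then
        (if P = {length Is}
         then a \<in> actions K - (\<Union>J\<in>set Is. actions J) \<union> {tau}
         else a \<noteq> tau \<and> a \<in> actions K \<and> participants tau Is a (P - {length Is}))
      else participants tau Is a P \<and> a \<in> - actions K \<union> {tau})"
proof -
  have S: "a \<noteq> tau \<Longrightarrow> {i. i < length (Is @ [K]) \<and> a \<in> actions ((Is @ [K]) ! i)} =
      {i. i < length Is \<and> a \<in> actions (Is ! i)} \<union> (if a \<in> actions K then {length Is} else {})"
    by (auto simp: less_Suc_eq nth_append)
  show ?thesis
  proof (cases "a = tau")
    case True
    then show ?thesis
      by (auto simp: participants_def is_singleton_def less_Suc_eq)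
  next
    case False
    let ?S = "{i. i < length Is \<and> a \<in> actions (Is ! i)}"
    have n: "length Is \<notin> ?S" by simp
    have ne: "?S = {} \<longleftrightarrow> a \<notin> (\<Union>J\<in>set Is. actions J)"
      unfolding set_conv_nth by auto
    have L: "participants tau (Is @ [K]) a P \<longleftrightarrow>
        P \<noteq> {} \<and> P = ?S \<union> (if a \<in> actions K then {length Is} else {})"
      unfolding participants_def S[OF False] using False by (auto split: if_splits)
    have R: "participants tau Is a Q \<longleftrightarrow> Q \<noteq> {} \<and> Q = ?S" for Q
      unfolding participants_def using False by auto
    show ?thesis unfolding L R using ne n False
      by (auto split: if_splits)
  qed
qed

text \<open>Induction on the list from its right end, following the nesting of the composition. Each
  rule of \<open>par\<close> matches one branch of \<open>participants_snoc\<close>; the renaming of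
  states to lists only appends the last entry.\<close>

lemma transitions_par_list:
  assumes "Is \<noteq> []"
    and "\<And>K s C a C' s'. K \<in> set Is \<Longrightarrow> (s, C, a, C', s') \<in> transitions K
           \<Longrightarrow> s \<in> states K \<and> a \<in> actions K"
  shows "(ss, C, a, C', ss') \<in> transitions (par_list tau Is) \<longleftrightarrow>
           (\<exists>P Cs Cs'. joint_step tau Is P Cs Cs' ss C a C' ss')"
  using assms
proof (induction Is arbitrary: ss C a C' ss' rule: rev_nonempty_induct)
  case (single K)
  have P: "participants tau [K] a P \<longleftrightarrow> P = {0} \<and> (a = tau \<or> a \<in> actions K)" for P
    by (auto simp: participants_def is_singleton_def)
  show ?case
  proof
    assume "(ss, C, a, C', ss') \<in> transitions (par_list tau [K])"
    then obtain s s' where "ss = [s]" "ss' = [s']" "(s, C, a, C', s') \<in> transitions K"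
      by (auto simp: par_list_single map_states_def)
    then have "joint_step tau [K] {0} (\<lambda>_. C) (\<lambda>_. C') ss C a C' ss'"
      using single.prems by (auto simp: joint_step_def P)
    then show "\<exists>P Cs Cs'. joint_step tau [K] P Cs Cs' ss C a C' ss'" by blast
  next
    assume "\<exists>P Cs Cs'. joint_step tau [K] P Cs Cs' ss C a C' ss'"
    then show "(ss, C, a, C', ss') \<in> transitions (par_list tau [K])"
      by (auto simp: joint_step_def P par_list_single length_Suc_conv
          intro: map_states_transitionI[of _ _ _ _ _ _ "\<lambda>s. [s]"])
  qed
next
  case (snoc K Is)
  let ?n = "length Is" and ?J = "par_list tau Is"
  have wf: "s \<in> states K \<and> a \<in> actions K" if "(s, C, a, C', s') \<in> transitions K" for s C a C' s'
    using that snoc.prems by auto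
  have IH: "(ss, C, a, C', ss') \<in> transitions ?J \<longleftrightarrow>
      (\<exists>P Cs Cs'. joint_step tau Is P Cs Cs' ss C a C' ss')" for ss C a C' ss'
    by (rule snoc.IH) (use snoc.prems in auto)
  note acts = actions_par_list[OF snoc.hyps, of tau]
  note sts = states_par_list[OF snoc.hyps, of tau]
  show ?case
  proof
    assume "(ss, C, a, C', ss') \<in> transitions (par_list tau (Is @ [K]))"
    then obtain us u us' u' where ss: "ss = us @ [u]" "ss' = us' @ [u']"
      and tr: "((us, u), C, a, C', (us', u')) \<in> transitions (par tau ?J K)"
      using snoc.hyps by (auto simp: par_list_snoc map_states_def)
    from tr consider
        (left) "(us, C, a, C', us') \<in> transitions ?J" "u' = u" "u \<in> states K"
          "a \<in> (actions ?J - actions K) \<union> {tau}"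
      | (right) "(u, C, a, C', u') \<in> transitions K" "us' = us" "us \<in> states ?J"
          "a \<in> (actions K - actions ?J) \<union> {tau}"
      | (both) C1 C1' C2 C2' where "(us, C1, a, C1', us') \<in> transitions ?J"
          "(u, C2, a, C2', u') \<in> transitions K" "a \<in> (actions ?J \<inter> actions K) - {tau}"
          "C = C1 \<union> C2" "C' = C1' \<union> C2'"
      unfolding par_transition_iff by blast
    then show "\<exists>P Cs Cs'. joint_step tau (Is @ [K]) P Cs Cs' ss C a C' ss'"
    proof cases
      case left
      then obtain P Cs Cs' where J: "joint_step tau Is P Cs Cs' us C a C' us'"
        using IH by blast
      then have "P \<subseteq> {..<?n}" by (auto simp: joint_step_def participants_def)
      then have "joint_step tau (Is @ [K]) P Cs Cs' ss C a C' ss'"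
        using J left unfolding joint_step_def participants_snoc ss
        by (auto simp: nth_append less_Suc_eq)
      then show ?thesis by blast
    next
      case right
      then have "joint_step tau (Is @ [K]) {?n} (\<lambda>_. C) (\<lambda>_. C') ss C a C' ss'"
        using wf[OF right(1)] unfolding joint_step_def participants_snoc ss sts acts
        by (auto simp: nth_append less_Suc_eq)
      then show ?thesis by blast
    next
      case both
      then obtain P Cs Cs' where J: "joint_step tau Is P Cs Cs' us C1 a C1' us'"
        using IH by blast
      then have P: "P \<subseteq> {..<?n}" "P \<noteq> {}" by (auto simp: joint_step_def participants_def)
      \<comment> \<open>These facts select the synchronising branch of
        \<open>participants_snoc\<close>: since \<open>P\<close> is nonempty,
        \<open>insert ?n P\<close> is not the singleton of the new index.\<close>
      then have P': "insert ?n P - {?n} = P" "insert ?n P \<noteq> {?n}" "\<not> P \<subseteq> {?n}" by auto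
      have upd: "(\<Union>i\<in>insert ?n P. (F(?n := X)) i) = (\<Union>i\<in>P. F i) \<union> X" for F :: "nat \<Rightarrow> 'c set" and X
        using P by (auto split: if_splits)
      have "participants tau (Is @ [K]) a (insert ?n P)"
        using J both unfolding joint_step_def participants_snoc P' by (simp add: P')
      then have "joint_step tau (Is @ [K]) (insert ?n P) (Cs(?n := C2)) (Cs'(?n := C2')) ss C a C' ss'"
        using J both P wf[OF both(2)] unfolding joint_step_def ss upd
        by (auto simp: nth_append less_Suc_eq)
      then show ?thesis by blast
    qed
  next
    assume "\<exists>P Cs Cs'. joint_step tau (Is @ [K]) P Cs Cs' ss C a C' ss'"
    then obtain P Cs Cs' where J: "joint_step tau (Is @ [K]) P Cs Cs' ss C a C' ss'" by blast
    then obtain us u us' u' where ss: "ss = us @ [u]" "ss' = us' @ [u']"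
        "length us = ?n" "length us' = ?n"
      by (auto simp: joint_step_def length_Suc_conv_rev)
    have P: "P \<subseteq> {..?n}" using J by (auto simp: joint_step_def participants_def)
    note J' = J[unfolded joint_step_def participants_snoc ss(1,2)]
    have all: "(us @ [u]) ! i \<in> states ((Is @ [K]) ! i)" if "i \<le> ?n" for i
      using J' that by simp
    have stt: "us \<in> states ?J" "u \<in> states K"
    proof -
      have "us ! i \<in> states (Is ! i)" if "i < ?n" for i
        using all[of i] that ss by (simp add: nth_append)
      then show "us \<in> states ?J" using ss sts by simp
      show "u \<in> states K" using all[of ?n] ss by (simp add: nth_append)
    qed
    have nP: "us' ! i = us ! i" if "i < ?n" "i \<notin> P" for i
      using J' ss that by (auto simp: nth_append less_Suc_eq)
    have iP: "(us ! i, Cs i, a, Cs' i, us' ! i) \<in> transitions (Is ! i)" if "i < ?n" "i \<in> P" for i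
      using J' ss that by (auto simp: nth_append less_Suc_eq)
    have KP: "(u, Cs ?n, a, Cs' ?n, u') \<in> transitions K" if "?n \<in> P"
      using J' ss that by (auto simp: nth_append)
    have KnP: "u' = u" if "?n \<notin> P"
      using J' ss that by (auto simp: nth_append)
    have CC: "C = (\<Union>i\<in>P. Cs i)" "C' = (\<Union>i\<in>P. Cs' i)" using J' by auto
    \<comment> \<open>Forgetting the last component leaves a joint step of the shorter list, with
      clock sets collected over the remaining participants. It serves both the resting and the
      synchronising case.\<close>
    have restrict: "joint_step tau Is Q Cs Cs' us (\<Union>i\<in>Q. Cs i) a (\<Union>i\<in>Q. Cs' i) us'"
      if "participants tau Is a Q" "Q = P - {?n}" for Q
    proof -
      have "i < ?n \<and> i \<in> P" if "i \<in> Q" for i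
        using that P \<open>Q = P - {?n}\<close> by fastforce
      then show ?thesis
        using that ss(3,4) stt(1) nP iP unfolding joint_step_def sts by auto
    qed
    have "((us, u), C, a, C', (us', u')) \<in> transitions (par tau ?J K)"
    proof (cases "?n \<in> P")
      case False
      then have p: "participants tau Is a P" "a \<in> - actions K \<union> {tau}" using J' by auto
      \<comment> \<open>The branch of \<open>participants_snoc\<close> only says that
        \<open>K\<close> does not block \<open>a\<close>. That the prefix knows \<open>a\<close>
        comes from \<open>P\<close> being nonempty.\<close>
      then have "a \<in> actions ?J \<union> {tau}"
        by (auto simp: participants_def acts set_conv_nth split: if_splits)
      moreover have "(us, C, a, C', us') \<in> transitions ?J"
        using restrict[of P] p False CC IH by auto
      ultimately show ?thesis using p KnP[OF False] stt unfolding par_transition_iff by blast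
    next
      case True
      show ?thesis
      proof (cases "P = {?n}")
        case True
        then have "a \<in> (actions K - actions ?J) \<union> {tau}" using J' acts by auto
        \<comment> \<open>No index below \<open>?n\<close> participates, so the whole prefix
          rests.\<close>
        moreover have "us' = us" using nP True ss by (intro nth_equalityI) auto
        ultimately show ?thesis using True KP stt CC unfolding par_transition_iff by simp
      next
        case False
        then have p: "a \<noteq> tau" "a \<in> actions K" "participants tau Is a (P - {?n})"
          using J' True by auto
        then have "a \<in> actions ?J"
          by (auto simp: participants_def acts set_conv_nth split: if_splits)
        moreover have "(us, (\<Union>i\<in>P - {?n}. Cs i), a, (\<Union>i\<in>P - {?n}. Cs' i), us') \<in> transitions ?J"
          using restrict p IH by blast
        moreover have "C = (\<Union>i\<in>P - {?n}. Cs i) \<union> Cs ?n" "C' = (\<Union>i\<in>P - {?n}. Cs' i) \<union> Cs' ?n"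
          using CC True by auto
        ultimately show ?thesis using p KP[OF True] unfolding par_transition_iff by blast
      qed
    qed
    from map_states_transitionI[OF this, of "\<lambda>(ss, s). ss @ [s]"]
    show "(ss, C, a, C', ss') \<in> transitions (par_list tau (Is @ [K]))"
      by (simp add: par_list_snoc[OF snoc.hyps] ss(1,2))
  qed
qed

section \<open>Enabled urgent outputs of the composition and of its components\<close>

locale IOSA_network =
  fixes tau :: 'a and Is :: "('s, 'a, 'c) iosa list"
  assumes nonempty: "Is \<noteq> []"
    and component: "i < length Is \<Longrightarrow> IOSA tau (Is ! i)"
    and pairwise_compatible:
      "i < length Is \<Longrightarrow> j < length Is \<Longrightarrow> i \<noteq> j \<Longrightarrow> compatible tau (Is ! i) (Is ! j)"
begin

abbreviation net :: "('s list, 'a, 'c) iosa" where "net \<equiv> par_list tau Is"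

lemma component_transition:
  assumes "i < length Is" "(s, C, a, C', s') \<in> transitions (Is ! i)"
  shows "s \<in> states (Is ! i)" "a \<in> actions (Is ! i)" "s' \<in> states (Is ! i)"
  using IOSA.transitions_wf[OF component[OF assms(1)]] assms(2) by auto

lemma transitions_net:
  "(ss, C, a, C', ss') \<in> transitions net \<longleftrightarrow>
     (\<exists>P Cs Cs'. joint_step tau Is P Cs Cs' ss C a C' ss')"
  by (rule transitions_par_list[OF nonempty])
    (metis component_transition(1,2) in_set_conv_nth)

lemma outputs_net: "outputs net = (\<Union>i<length Is. outputs (Is ! i))"
  by (auto simp: outputs_par_list[OF nonempty] set_conv_nth)

lemma urgent_net: "urgent net = (\<Union>i<length Is. urgent (Is ! i))"
  by (auto simp: urgent_par_list[OF nonempty] set_conv_nth)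

lemma actions_net: "actions net = (\<Union>i<length Is. actions (Is ! i))"
  by (auto simp: actions_par_list[OF nonempty] set_conv_nth)

lemma tau_urgent_output:
  "i < length Is \<Longrightarrow> tau \<in> urgent (Is ! i)" "i < length Is \<Longrightarrow> tau \<in> outputs (Is ! i)"
  using IOSA.tau_urgent_output[OF component] by auto

text \<open>The last condition of compatibility makes components sharing an action agree on its
  urgency, so urgency can be read off globally.\<close>

lemma urgent_component_iff:
  assumes "i < length Is" "a \<in> actions (Is ! i)"
  shows "a \<in> urgent (Is ! i) \<longleftrightarrow> a \<in> urgent net"
proof -
  have "a \<in> urgent (Is ! i)" if "j < length Is" "a \<in> urgent (Is ! j)" for j
    using pairwise_compatible[of i j] assms that by (cases "i = j") (auto simp: compatible_def)
  then show ?thesis using assms by (auto simp: urgent_net)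
qed

lemma participant_action:
  assumes "participants tau Is a P" "i \<in> P"
  shows "i < length Is" "a \<in> actions (Is ! i)"
  using assms tau_urgent_output by (auto simp: participants_def actions_def split: if_splits)

lemma participants_exist:
  assumes "i < length Is" "a \<in> actions (Is ! i)"
  obtains P where "participants tau Is a P" "i \<in> P"
proof (cases "a = tau")
  case True
  then show ?thesis using that[of "{i}"] assms by (simp add: participants_def)
next
  case False
  then show ?thesis
    using that[of "{j. j < length Is \<and> a \<in> actions (Is ! j)}"] assms
    by (auto simp: participants_def)
qed

lemma other_participant_input:
  assumes "participants tau Is a P" "i \<in> P" "j \<in> P" "i \<noteq> j" "a \<in> outputs (Is ! i)"
  shows "a \<in> inputs (Is ! j)"
proof -
  \<comment> \<open>Two distinct participants rule out \<open>tau\<close>, whose set of participants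
    is a singleton; hence the overlap of outputs permitted by compatibility does not arise.\<close>
  have "a \<noteq> tau" using assms by (auto simp: participants_def is_singleton_def)
  moreover have "compatible tau (Is ! i) (Is ! j)"
    using assms pairwise_compatible participant_action(1) by blast
  ultimately have "a \<notin> outputs (Is ! j)" using assms(5) by (auto simp: compatible_def)
  then show ?thesis using participant_action(2)[OF assms(1,3)] by (auto simp: actions_def)
qed

lemma joint_step_target:
  assumes "joint_step tau Is P Cs Cs' ss C a C' ss'" "i < length Is"
  shows "ss' ! i \<in> states (Is ! i)"
  using assms component_transition(3) by (cases "i \<in> P") (auto simp: joint_step_def)

text \<open>Local transitions can be chosen independently, because a joint step merely takes unions
  of their clock sets.\<close>

lemma joint_step_exists:
  assumes P: "participants tau Is a P"
    and ss: "length ss = length Is" "\<And>i. i < length Is \<Longrightarrow> ss ! i \<in> states (Is ! i)"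
    and en: "\<And>i. i \<in> P \<Longrightarrow> \<exists>C C' s'. (ss ! i, C, a, C', s') \<in> transitions (Is ! i)"
  obtains C C' ss' where "(ss, C, a, C', ss') \<in> transitions net"
proof -
  obtain Cs Cs' S where S: "\<And>i. i \<in> P \<Longrightarrow> (ss ! i, Cs i, a, Cs' i, S i) \<in> transitions (Is ! i)"
    using en by metis
  define ss' where "ss' = map (\<lambda>i. if i \<in> P then S i else ss ! i) [0..<length Is]"
  have "joint_step tau Is P Cs Cs' ss (\<Union>i\<in>P. Cs i) a (\<Union>i\<in>P. Cs' i) ss'"
    using P ss S participant_action(1)[OF P] by (auto simp: joint_step_def ss'_def)
  then show ?thesis using that transitions_net by blast
qed

text \<open>From left to right, the participant owning the output can itself move. From right to
  left, the other participants have the action as an input and cannot block it, by input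
  enabledness.\<close>

lemma uen_outputs_net:
  assumes ss: "length ss = length Is" "\<And>i. i < length Is \<Longrightarrow> ss ! i \<in> states (Is ! i)"
  shows "uen net ss \<inter> outputs net =
           (\<Union>i<length Is. uen (Is ! i) (ss ! i) \<inter> outputs (Is ! i))"
proof (intro set_eqI iffI)
  fix b assume b: "b \<in> uen net ss \<inter> outputs net"
  then obtain P Cs Cs' C C' ss' where J: "joint_step tau Is P Cs Cs' ss C b C' ss'"
    by (auto simp: uen_def transitions_net)
  then have P: "participants tau Is b P" by (simp add: joint_step_def)
  \<comment> \<open>For \<open>tau\<close> any participant will do, since all components have it as
    an output. Otherwise the component that outputs \<open>b\<close> participates, as all components
    knowing \<open>b\<close> do.\<close>
  obtain i where i: "i \<in> P" "b \<in> outputs (Is ! i)"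
  proof (cases "b = tau")
    case True
    then show ?thesis using P that tau_urgent_output(2) participant_action(1)
      by (metis ex_in_conv participants_def)
  next
    case False
    then show ?thesis using P that b by (auto simp: participants_def outputs_net actions_def)
  qed
  have "(ss ! i, Cs i, b, Cs' i, ss' ! i) \<in> transitions (Is ! i)"
    using J i(1) by (simp add: joint_step_def)
  then have "b \<in> uen (Is ! i) (ss ! i)"
    using b urgent_component_iff[OF participant_action[OF P i(1)]] by (auto simp: uen_def)
  then show "b \<in> (\<Union>i<length Is. uen (Is ! i) (ss ! i) \<inter> outputs (Is ! i))"
    using i participant_action(1)[OF P] by blast
next
  fix b assume "b \<in> (\<Union>i<length Is. uen (Is ! i) (ss ! i) \<inter> outputs (Is ! i))"
  then obtain i where i: "i < length Is" "b \<in> uen (Is ! i) (ss ! i)" "b \<in> outputs (Is ! i)"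
    by auto
  then have "b \<in> actions (Is ! i)" by (simp add: actions_def)
  with i obtain P where P: "participants tau Is b P" "i \<in> P"
    using participants_exist by blast
  have "\<exists>C C' s'. (ss ! j, C, b, C', s') \<in> transitions (Is ! j)" if "j \<in> P" for j
  proof (cases "j = i")
    case True
    then show ?thesis using i by (auto simp: uen_def)
  next
    case False
    have "j < length Is" using participant_action(1)[OF P(1) that] .
    then show ?thesis
      using other_participant_input[OF P that _ i(3)] False
        IOSA.input_enabled[OF component] ss(2) by metis
  qed
  then obtain C C' ss' where "(ss, C, b, C', ss') \<in> transitions net"
    using joint_step_exists[OF P(1) ss] by blast
  then show "b \<in> uen net ss \<inter> outputs net"
    using i by (auto simp: uen_def urgent_net outputs_net)
qed

section \<open>Confluence of the composition from confluence of the components\<close>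

text \<open>The closing diamond is built componentwise. A component moved by both actions closes by
  its own confluence; one moved by a single action is untouched by the other, so the two steps
  commute there.\<close>

lemma confluent_at_net:
  assumes conf: "\<And>i. i < length Is \<Longrightarrow> confluent_wrt (Is ! i) a b"
  shows "confluent_at net ss a b"
  unfolding confluent_at_def
proof (intro allI impI, elim conjE)
  fix C1 s1 C2 s2
  assume "(ss, {}, a, C1, s1) \<in> transitions net" "(ss, {}, b, C2, s2) \<in> transitions net"
  then obtain P Cs Cs' Q Ds Ds' where
      J: "joint_step tau Is P Cs Cs' ss {} a C1 s1" and K: "joint_step tau Is Q Ds Ds' ss {} b C2 s2"
    unfolding transitions_net by blast
  have PQ: "P \<subseteq> {..<length Is}" "Q \<subseteq> {..<length Is}"
    using J K by (auto simp: joint_step_def participants_def)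
  \<comment> \<open>A union of clock sets is empty only if each member is, so the local steps also
    wait for no clock and local confluence applies.\<close>
  have empt: "i \<in> P \<Longrightarrow> Cs i = {}" "i \<in> Q \<Longrightarrow> Ds i = {}" for i
    using J K by (auto simp: joint_step_def)
  have tr: "i \<in> P \<Longrightarrow> (ss ! i, {}, a, Cs' i, s1 ! i) \<in> transitions (Is ! i)"
      "i \<in> Q \<Longrightarrow> (ss ! i, {}, b, Ds' i, s2 ! i) \<in> transitions (Is ! i)" for i
    using J K empt unfolding joint_step_def by metis+
  \<comment> \<open>The implication makes the claim total in \<open>i\<close>, so that a choice
    function \<open>T\<close> can be extracted.\<close>
  have "\<exists>t. i \<in> P \<inter> Q \<longrightarrow> (s1 ! i, {}, b, Ds' i, t) \<in> transitions (Is ! i) \<and>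
      (s2 ! i, {}, a, Cs' i, t) \<in> transitions (Is ! i)" for i
  proof (cases "i \<in> P \<inter> Q")
    case True
    then have "i < length Is" using PQ by auto
    then have "confluent_at (Is ! i) (ss ! i) a b"
      using conf J by (simp add: confluent_wrt_def joint_step_def)
    then show ?thesis using tr True unfolding confluent_at_def by blast
  qed auto
  then obtain T where T: "\<And>i. i \<in> P \<Longrightarrow> i \<in> Q \<Longrightarrow>
      (s1 ! i, {}, b, Ds' i, T i) \<in> transitions (Is ! i) \<and>
      (s2 ! i, {}, a, Cs' i, T i) \<in> transitions (Is ! i)"
    by (metis IntI)
  \<comment> \<open>Outside \<open>P\<close> the entry of \<open>s2\<close> is right in both cases:
    it is the target of \<open>b\<close> for an index in \<open>Q\<close>, and the unchanged entry
    of \<open>ss\<close> otherwise.\<close>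
  define s3 where "s3 = map (\<lambda>i. if i \<in> P then if i \<in> Q then T i else s1 ! i else s2 ! i)
      [0..<length Is]"
  have s3: "i < length Is \<Longrightarrow>
      s3 ! i = (if i \<in> P then if i \<in> Q then T i else s1 ! i else s2 ! i)" for i
    by (simp add: s3_def)
  have len: "length s3 = length Is" by (simp add: s3_def)
  have keep: "i < length Is \<Longrightarrow> i \<notin> P \<Longrightarrow> s1 ! i = ss ! i"
      "i < length Is \<Longrightarrow> i \<notin> Q \<Longrightarrow> s2 ! i = ss ! i" for i
    using J K by (auto simp: joint_step_def)
  \<comment> \<open>Local confluence preserves the reset sets, so the family \<open>Ds'\<close>
    again has union \<open>C2\<close>. At an index in \<open>Q\<close> but not in \<open>P\<close>,
    \<open>s1\<close> agrees with \<open>ss\<close> and the original \<open>b\<close> step is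
    reused.\<close>
  have "joint_step tau Is Q (\<lambda>_. {}) Ds' s1 {} b C2 s3"
    using J K joint_step_target[OF J] T tr keep PQ len s3 by (auto simp: joint_step_def)
  moreover have "joint_step tau Is P (\<lambda>_. {}) Cs' s2 {} a C1 s3"
    using J K joint_step_target[OF K] T tr keep PQ len s3 by (auto simp: joint_step_def)
  ultimately show "\<exists>s3. (s1, {}, b, C2, s3) \<in> transitions net \<and> (s2, {}, a, C1, s3) \<in> transitions net"
    unfolding transitions_net by blast
qed

section \<open>Tracing enabled urgent outputs back to their sources\<close>

text \<open>The two disjuncts are the alternatives (i) and (ii) of the theorem, stated for a whole
  set: \<open>c\<close> and \<open>d\<close> will come from one such set and hence share the
  alternative and the action \<open>e\<close>.\<close>

definition source_set :: "'a set \<Rightarrow> bool" where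
  "source_set S \<longleftrightarrow>
     S \<subseteq> (\<Union>i<length Is. uen (Is ! i) (init_state (Is ! i)) \<inter> outputs (Is ! i)) \<or>
     (\<exists>e \<in> actions net. \<exists>B :: nat \<Rightarrow> 'a set.
        (\<forall>i<length Is. spontaneously_enabled (Is ! i) e (B i)) \<and> S \<subseteq> (\<Union>i<length Is. B i))"

lemma source_set_subset:
  assumes "source_set S" "T \<subseteq> S"
  shows "source_set T"
  using assms(1) unfolding source_set_def
proof (elim disjE bexE exE conjE)
  fix e and B :: "nat \<Rightarrow> 'a set"
  assume "e \<in> actions net" "\<forall>i<length Is. spontaneously_enabled (Is ! i) e (B i)"
    and "S \<subseteq> (\<Union>i<length Is. B i)"
  with assms(2) show "T \<subseteq> (\<Union>i<length Is. uen (Is ! i) (init_state (Is ! i)) \<inter> outputs (Is ! i)) \<or>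
     (\<exists>e \<in> actions net. \<exists>B :: nat \<Rightarrow> 'a set.
        (\<forall>i<length Is. spontaneously_enabled (Is ! i) e (B i)) \<and> T \<subseteq> (\<Union>i<length Is. B i))"
    by (intro disjI2 bexI[of _ e] exI[of _ B] conjI) simp_all
qed (intro disjI1, rule subset_trans[OF assms(2)])

text \<open>The path invariant. A single \<open>S\<close> must account for all enabled urgent
  outputs at once.\<close>

definition traced :: "'s list \<Rightarrow> bool" where
  "traced ss \<longleftrightarrow>
     (\<exists>S. source_set S \<and>
       (\<forall>x \<in> uen net ss \<inter> outputs net. \<exists>c\<in>S. (c, x) \<in> (approx_triggering Is)\<^sup>*))"

text \<open>Component reachability is carried along with \<open>traced\<close> because triggering
  and spontaneous enabling in a component speak of its potentially reachable states. An urgent step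
  keeps the source set; a non-urgent step starts a new one.\<close>

lemma reachable_components_traced:
  assumes "closed_iosa net" "potentially_reachable net ss"
  shows "length ss = length Is \<and>
    (\<forall>i<length Is. ss ! i \<in> states (Is ! i) \<and> potentially_reachable (Is ! i) (ss ! i)) \<and>
    traced ss"
  using assms(2)
proof (induction rule: potentially_reachable_induct)
  case init
  let ?ss = "init_state net"
  have init: "?ss = map init_state Is" by (rule init_state_par_list[OF nonempty])
  have st: "i < length Is \<Longrightarrow> ?ss ! i \<in> states (Is ! i)" for i
    using IOSA.init_state_wf[OF component] by (simp add: init)
  have "source_set (uen net ?ss \<inter> outputs net)"
    unfolding source_set_def using uen_outputs_net[OF _ st] by (auto simp: init)
  then have "traced ?ss" by (auto simp: traced_def)
  then show ?case using st potentially_reachable_init by (auto simp: init)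
next
  case (step ss C a C' ss')
  let ?uo = "\<lambda>i s. uen (Is ! i) s \<inter> outputs (Is ! i)"
  have len: "length ss = length Is" and st: "\<And>i. i < length Is \<Longrightarrow> ss ! i \<in> states (Is ! i)"
    and reach: "\<And>i. i < length Is \<Longrightarrow> potentially_reachable (Is ! i) (ss ! i)"
    using step.IH by auto
  note uo = uen_outputs_net[OF len st]
  obtain P Cs Cs' where J: "joint_step tau Is P Cs Cs' ss C a C' ss'"
    using step.hyps(2) transitions_net by blast
  then have P: "participants tau Is a P" by (simp add: joint_step_def)
  note act = participant_action[OF P]
  have len': "length ss' = length Is" using J by (simp add: joint_step_def)
  have st': "\<And>i. i < length Is \<Longrightarrow> ss' ! i \<in> states (Is ! i)" using joint_step_target[OF J] .
  note uo' = uen_outputs_net[OF len' st']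
  have tr: "(ss ! i, Cs i, a, Cs' i, ss' ! i) \<in> transitions (Is ! i)" if "i \<in> P" for i
    using J that by (simp add: joint_step_def)
  have keep: "ss' ! i = ss ! i" if "i < length Is" "i \<notin> P" for i
    using J that by (simp add: joint_step_def)
  have reach': "potentially_reachable (Is ! i) (ss' ! i)" if i: "i < length Is" for i
  proof (cases "i \<in> P")
    case True
    \<comment> \<open>Plausibility projects: an urgent output enabled in the component is enabled in
      the composition, which forces \<open>a\<close> to be urgent there and hence in the
      component.\<close>
    have "a \<in> urgent (Is ! i)" if "?uo i (ss ! i) \<noteq> {}"
      using that i step.hyps(3) uo urgent_component_iff[OF act[OF True]] by auto
    then show ?thesis
      using potentially_reachable_step[OF reach[OF i] tr[OF True]] by blast
  qed (use keep reach i in simp)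
  have "traced ss'"
  proof (cases "a \<in> urgent net")
    case True
    obtain S where S: "source_set S"
        "\<And>x. x \<in> uen net ss \<inter> outputs net \<Longrightarrow> \<exists>c\<in>S. (c, x) \<in> (approx_triggering Is)\<^sup>*"
      using step.IH by (auto simp: traced_def)
    \<comment> \<open>Closedness turns the urgent action \<open>a\<close> into an output, so the
      induction hypothesis traces \<open>a\<close> itself back to some \<open>c\<close>.\<close>
    have "a \<in> outputs net"
      using assms(1) act P actions_net
      by (auto simp: closed_iosa_def actions_def participants_def)
    then obtain c where c: "c \<in> S" "(c, a) \<in> (approx_triggering Is)\<^sup>*"
      using S(2)[of a] True step.hyps(2) by (auto simp: uen_def)
    have "\<exists>c\<in>S. (c, x) \<in> (approx_triggering Is)\<^sup>*" if "x \<in> uen net ss' \<inter> outputs net" for x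
    proof (cases "x \<in> uen net ss \<inter> outputs net")
      case False
      obtain i where i: "i < length Is" "x \<in> ?uo i (ss' ! i)" using \<open>x \<in> _\<close> uo' by auto
      \<comment> \<open>As \<open>x\<close> is an output of component \<open>i\<close>, being
        enabled there before the step would make it enabled in the composition. So it is new, and
        component \<open>i\<close> must have moved.\<close>
      then have x: "x \<notin> uen (Is ! i) (ss ! i)" using False uo by auto
      then have iP: "i \<in> P" using keep[OF i(1)] i(2) by (cases "i \<in> P") auto
      obtain D D' t where t: "(ss' ! i, D, x, D', t) \<in> transitions (Is ! i)"
        using i by (auto simp: uen_def)
      have "x \<in> urgent (Is ! i)" using i by (auto simp: uen_def)
      \<comment> \<open>Triggering also asks for the state after \<open>x\<close> to be potentially
        reachable; this holds because a step with an urgent action is always plausible.\<close>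
      then have "potentially_reachable (Is ! i) t"
        using potentially_reachable_step[OF reach'[OF i(1)] t] by blast
      moreover have "a \<in> urgent (Is ! i)" using True urgent_component_iff[OF act[OF iP]] by simp
      ultimately have "triggers (Is ! i) a x"
        using reach[OF i(1)] reach'[OF i(1)] tr[OF iP] t x i \<open>x \<in> urgent (Is ! i)\<close>
        unfolding triggers_def by blast
      then have "(a, x) \<in> approx_triggering Is" using i by (auto simp: approx_triggering_def)
      then show ?thesis using c by (meson rtrancl.rtrancl_into_rtrancl)
    qed (use S in blast)
    then show ?thesis using S(1) by (auto simp: traced_def)
  next
    case False
    \<comment> \<open>A plausible non-urgent step is only possible when no urgent output is enabled,
      so every component is stable beforehand.\<close>
    then have none: "?uo i (ss ! i) = {}" if "i < length Is" for i
      using step.hyps(3) uo that by auto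
    \<comment> \<open>Resting components get the empty set: they perform no \<open>a\<close>, and
      may not even have it as an action.\<close>
    define B where "B i = (if i \<in> P then ?uo i (ss' ! i) else {})" for i
    have "spontaneously_enabled (Is ! i) a (B i)" if i: "i < length Is" for i
    proof (cases "i \<in> P")
      case iP: True
      have "stable (Is ! i) (ss ! i)"
        using none[OF i] by (auto simp: stable_def uen_def)
      moreover have "a \<in> actions (Is ! i) - urgent (Is ! i)"
        using act[OF iP] urgent_component_iff False by auto
      moreover have "B i \<subseteq> urgent (Is ! i) \<inter> outputs (Is ! i)" "B i \<subseteq> uen (Is ! i) (ss' ! i)"
        by (auto simp: B_def uen_def)
      ultimately show ?thesis
        using reach[OF i] reach'[OF i] tr[OF iP] unfolding spontaneously_enabled_def by blast
    qed (simp add: B_def spontaneously_enabled_def)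
    moreover have "a \<in> actions net"
      using act P actions_net by (auto simp: participants_def)
    moreover have "uen net ss' \<inter> outputs net \<subseteq> (\<Union>i<length Is. B i)"
    proof
      fix x assume "x \<in> uen net ss' \<inter> outputs net"
      then obtain i where i: "i < length Is" "x \<in> ?uo i (ss' ! i)" using uo' by auto
      \<comment> \<open>A resting component keeps its state and thus still enables no urgent
        output.\<close>
      then have "i \<in> P" using none keep by fastforce
      then show "x \<in> (\<Union>i<length Is. B i)" using i by (auto simp: B_def)
    qed
    ultimately have "source_set (uen net ss' \<inter> outputs net)"
      unfolding source_set_def by blast
    then show ?thesis by (auto simp: traced_def)
  qed
  then show ?case using len' st' reach' by blast
qed

end

section \<open>From a potentially reachable non-confluent state to the sources of its conflicting
  actions\<close>

theorem theorem5:
  fixes tau :: 'a and Is :: "('s, 'a, 'c) iosa list" and I :: "('s list, 'a, 'c) iosa"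
  assumes "Is \<noteq> []"
    and "\<forall>i<length Is. IOSA tau (Is ! i)"
    and "\<forall>i<length Is. \<forall>j<length Is. i \<noteq> j \<longrightarrow> compatible tau (Is ! i) (Is ! j)"
    and "I = par_list tau Is"
    and "closed_iosa I"
    and "\<exists>s. potentially_reachable I s \<and> nonconfluent_state I s"
  shows "\<exists>a \<in> urgent I \<inter> outputs I. \<exists>b \<in> urgent I \<inter> outputs I.
           (\<exists>i<length Is. \<not> confluent_wrt (Is ! i) a b) \<and>
           (\<exists>c d. (c, a) \<in> (approx_triggering Is)\<^sup>* \<and> (d, b) \<in> (approx_triggering Is)\<^sup>* \<and>
              ({c, d} \<subseteq> (\<Union>i<length Is. uen (Is ! i) (init_state (Is ! i)) \<inter> outputs (Is ! i)) \<or>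
               (\<exists>e \<in> actions I. \<exists>B :: nat \<Rightarrow> 'a set.
                  (\<forall>i<length Is. spontaneously_enabled (Is ! i) e (B i)) \<and>
                  {c, d} \<subseteq> (\<Union>i<length Is. B i))))"
proof -
  interpret IOSA_network tau Is by (rule IOSA_network.intro) (use assms(1-3) in auto)
  have I: "I = net" by fact
  obtain s a b where s: "potentially_reachable net s" and urg: "a \<in> urgent net" "b \<in> urgent net"
    and nc: "\<not> confluent_at net s a b"
    using assms(6) unfolding I nonconfluent_state_def by blast
  have closed: "closed_iosa net" using assms(5) I by simp
  \<comment> \<open>Confluence at \<open>s\<close> would hold vacuously if either action had no
    transition from \<open>s\<close>.\<close>
  have en: "a \<in> uen net s" "b \<in> uen net s"
    using nc urg by (auto simp: confluent_at_def uen_def)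
  have "urgent net \<subseteq> outputs net"
  proof -
    have "urgent net \<subseteq> actions net"
      using IOSA.urgent_actions[OF component] by (fastforce simp: urgent_net actions_net)
    then show ?thesis using closed by (simp add: closed_iosa_def actions_def)
  qed
  then have out: "a \<in> outputs net" "b \<in> outputs net" using urg by auto
  obtain S where S: "source_set S"
      "\<And>x. x \<in> uen net s \<inter> outputs net \<Longrightarrow> \<exists>c\<in>S. (c, x) \<in> (approx_triggering Is)\<^sup>*"
    using reachable_components_traced[OF closed s] by (auto simp: traced_def)
  \<comment> \<open>Both sources are taken from the same \<open>S\<close>, so \<open>{c, d}\<close>
    inherits \<open>source_set\<close> as a subset.\<close>
  obtain c d where cd: "c \<in> S" "d \<in> S"
      "(c, a) \<in> (approx_triggering Is)\<^sup>*" "(d, b) \<in> (approx_triggering Is)\<^sup>*"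
    using S(2) en out by (meson IntI)
  have "\<exists>i<length Is. \<not> confluent_wrt (Is ! i) a b"
    using confluent_at_net nc by blast
  moreover have "source_set {c, d}"
    using source_set_subset[OF S(1)] cd(1,2) by simp
  ultimately show ?thesis
    using urg out cd(3,4) unfolding I source_set_def
    by (intro bexI[of _ a] bexI[of _ b] conjI exI[of _ c] exI[of _ d] IntI)
qed

end
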